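(* The probability that a growing self-avoiding walk (GSAW) on the bi-infinite triangular ladder $\Delta_\infty$ terminates is $1$.
   Context: $\Delta_\infty$ is the graph with vertex set $\{(a,b): a\in\mathbb{Z},\ b\in\{0,1\},\ a+b \text{ even}\}$, where $(x_1,y_1)$ and $(x_2,y_2)$ are adjacent iff ($|x_1-x_2|=1$ and $|y_1-y_2|=1$) or ($y_1=y_2$ and $|x_1-x_2|=2$). All starting vertices are equivalent by symmetry. A growing self-avoiding walk (GSAW) on a graph is the random process that starts at a given vertex and at each step moves to a vertex chosen uniformly at random among the neighbors of the current vertex that have not yet been visited; it terminates (is trapped) when the current vertex has no unvisited neighbor. *)

theory Defs
  imports "HOL-Probability.Probability"
begin

definition ladder_vertices :: "(int \<times> int) set" where
  "ladder_vertices = {(a, b). b \<in> {0, 1} \<and> even (a + b)}"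

definition ladder_adj :: "int \<times> int \<Rightarrow> int \<times> int \<Rightarrow> bool" where
  "ladder_adj = (\<lambda>(x1, y1) (x2, y2).
     (x1, y1) \<in> ladder_vertices \<and> (x2, y2) \<in> ladder_vertices \<and>
     (\<bar>x1 - x2\<bar> = 1 \<and> \<bar>y1 - y2\<bar> = 1 \<or> y1 = y2 \<and> \<bar>x1 - x2\<bar> = 2))"

text \<open>The unvisited neighbours of the current vertex \<open>w n\<close> when the walk so far is
  \<open>w 0, \<dots>, w n\<close>.\<close>

definition unvisited_nbrs :: "('v \<Rightarrow> 'v \<Rightarrow> bool) \<Rightarrow> (nat \<Rightarrow> 'v) \<Rightarrow> nat \<Rightarrow> 'v set" where
  "unvisited_nbrs E w n = {v. E (w n) v \<and> v \<notin> w ` {..n}}"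

definition trapped :: "('v \<Rightarrow> 'v \<Rightarrow> bool) \<Rightarrow> (nat \<Rightarrow> 'v) \<Rightarrow> nat \<Rightarrow> bool" where
  "trapped E w n \<longleftrightarrow> unvisited_nbrs E w n = {}"

text \<open>The conditional law of the position at time \<open>n\<close> given the positions \<open>w i\<close>, \<open>i < n\<close>.
  To have trajectories defined at all times, a trapped walk is left where it is; it then stays
  trapped. The graph has to be locally finite (\<^const>\<open>pmf_of_set\<close> is unspecified on infinite
  sets).\<close>

fun gsaw_step :: "('v \<Rightarrow> 'v \<Rightarrow> bool) \<Rightarrow> 'v \<Rightarrow> nat \<Rightarrow> (nat \<Rightarrow> 'v) \<Rightarrow> 'v pmf" where
  "gsaw_step E s 0 w = return_pmf s"
| "gsaw_step E s (Suc n) w =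
     (if trapped E w n then return_pmf (w n) else pmf_of_set (unvisited_nbrs E w n))"

lemma Ionescu_Tulcea_gsaw_step:
  fixes E :: "'v::countable \<Rightarrow> 'v \<Rightarrow> bool"
  shows "Ionescu_Tulcea (\<lambda>n w. measure_pmf (gsaw_step E s n w)) (\<lambda>_. count_space UNIV)"
proof
  fix n :: nat
  have "countable ({0..<n} \<rightarrow>\<^sub>E (UNIV :: 'v set))"
    by (intro countable_PiE) auto
  then have "Pi\<^sub>M {0..<n} (\<lambda>_. count_space (UNIV :: 'v set)) = count_space ({0..<n} \<rightarrow>\<^sub>E UNIV)"
    by (intro count_space_PiM_finite) auto
  then show "(\<lambda>w. measure_pmf (gsaw_step E s n w)) \<in>
      Pi\<^sub>M {0..<n} (\<lambda>_. count_space UNIV) \<rightarrow>\<^sub>M subprob_algebra (count_space UNIV)"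
    by (simp add: space_subprob_algebra prob_space_imp_subprob_space measure_pmf.prob_space_axioms)
qed

interpretation gsaw: Ionescu_Tulcea
  "\<lambda>n w. measure_pmf (gsaw_step E s n w)" "\<lambda>_. count_space UNIV"
  for E :: "'v::countable \<Rightarrow> 'v \<Rightarrow> bool" and s :: 'v
  by (rule Ionescu_Tulcea_gsaw_step)

text \<open>The law of the growing self-avoiding walk from \<open>s\<close>, as the Ionescu-Tulcea measure on
  trajectories determined by the step kernels.\<close>

definition gsaw :: "('v::countable \<Rightarrow> 'v \<Rightarrow> bool) \<Rightarrow> 'v \<Rightarrow> (nat \<Rightarrow> 'v) measure" where
  "gsaw E s = gsaw.PF.lim E s"

lemma sets_gsaw: "sets (gsaw E s) = sets (Pi\<^sub>M UNIV (\<lambda>_. count_space UNIV))"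
  unfolding gsaw_def by (rule gsaw.PF.sets_lim)

lemma space_gsaw: "space (gsaw E s) = UNIV"
  using sets_eq_imp_space_eq[OF sets_gsaw[of E s]] by (simp add: space_PiM)

lemma gsaw_step_cong: "(\<And>i. i < n \<Longrightarrow> w i = w' i) \<Longrightarrow> gsaw_step E s n w = gsaw_step E s n w'"
proof (cases n)
  case (Suc m) assume *: "\<And>i. i < n \<Longrightarrow> w i = w' i"
  have "w ` {..m} = w' ` {..m}" by (rule image_cong) (use * Suc in auto)
  moreover have "w m = w' m" using * Suc by auto
  ultimately show ?thesis using Suc by (simp only: gsaw_step.simps trapped_def unvisited_nbrs_def)
qed simp

lemma PiM_count_space_initial:
  fixes n :: nat
  shows "Pi\<^sub>M {0..<n} (\<lambda>_. count_space (UNIV :: 'v::countable set)) =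
    count_space ({0..<n} \<rightarrow>\<^sub>E UNIV)"
  by (intro count_space_PiM_finite countable_PiE) auto

lemma emeasure_gsaw_C:
  fixes E :: "'v::countable \<Rightarrow> _"
  shows "emeasure (gsaw.C E s 0 n (\<lambda>_. undefined)) {restrict p {0..<n}} =
    (\<Prod>i<n. ennreal (pmf (gsaw_step E s i p) (p i)))"
proof (induction n)
  case 0 show ?case by (simp add: PiM_empty restrict_def)
next
  case (Suc n)
  let ?M = "Pi\<^sub>M {0..<n} (\<lambda>_. count_space (UNIV::'v set))"
  let ?C = "gsaw.C E s 0 n (\<lambda>_. undefined)"
  have u: "(\<lambda>_. undefined) \<in> space (Pi\<^sub>M {0..<0} (\<lambda>_. count_space (UNIV::'v set)))"
    by (simp add: space_PiM PiE_def extensional_def)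
  have spC: "space ?C = space ?M" using gsaw.space_C[OF u, of E s n] by simp
  have stC: "sets ?C = sets ?M" using gsaw.sets_C[OF u, of E s n] by simp
  have S: "{restrict p {0..<Suc n}} \<in> sets (Pi\<^sub>M {0..<Suc n} (\<lambda>_. count_space (UNIV::'v set)))"
    by (simp add: PiM_count_space_initial)
  have ne: "space ?C \<noteq> {}" by (simp add: spC)
  have key: "emeasure (gsaw.eP E s n w) {restrict p {0..<Suc n}} =
      ennreal (pmf (gsaw_step E s n p) (p n)) * indicator {restrict p {0..<n}} w"
    if w: "w \<in> space ?M" for w
  proof -
    have undef: "w i = undefined" if "i \<ge> n" for i
      using w that by (auto simp: space_PiM PiE_def extensional_def)
    have iff: "w(n := x) = restrict p {0..<Suc n} \<longleftrightarrow> w = restrict p {0..<n} \<and> x = p n" for x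
    proof
      assume a: "w(n := x) = restrict p {0..<Suc n}"
      have "w i = restrict p {0..<n} i" for i
        using fun_cong[OF a, of i] undef[of i] by (auto split: if_splits simp: restrict_def)
      moreover have "x = p n"
        using fun_cong[OF a, of n] by simp
      ultimately show "w = restrict p {0..<n} \<and> x = p n"
        by auto
    qed (auto simp: restrict_def fun_eq_iff)
    have step: "gsaw_step E s n (restrict p {0..<n}) = gsaw_step E s n p"
      by (rule gsaw_step_cong) simp
    have "(\<lambda>x. w(n := x)) -` {restrict p {0..<Suc n}} \<inter> space (count_space UNIV) =
        {x. w = restrict p {0..<n} \<and> x = p n}"
      unfolding vimage_def singleton_iff iff by simp
    then have "emeasure (gsaw.eP E s n w) {restrict p {0..<Suc n}} =
        emeasure (measure_pmf (gsaw_step E s n w)) {x. w = restrict p {0..<n} \<and> x = p n}"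
      by (simp only: gsaw.emeasure_eP[OF w S])
    also have "\<dots> = ennreal (pmf (gsaw_step E s n p) (p n)) * indicator {restrict p {0..<n}} w"
    proof (cases "w = restrict p {0..<n}")
      case True
      then show ?thesis
        unfolding True step by (simp add: emeasure_pmf_single)
    next
      case False
      then show ?thesis by simp
    qed
    finally show ?thesis .
  qed
  have "emeasure (gsaw.C E s 0 (Suc n) (\<lambda>_. undefined)) {restrict p {0..<Suc n}} =
      (\<integral>\<^sup>+w. emeasure (gsaw.eP E s n w) {restrict p {0..<Suc n}} \<partial>?C)"
    unfolding gsaw.C.simps add_0
  proof (rule emeasure_bind[OF ne _ S])
    show "gsaw.eP E s n \<in> ?C \<rightarrow>\<^sub>M subprob_algebra
        (Pi\<^sub>M {0..<Suc n} (\<lambda>_. count_space (UNIV::'v set)))"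
      unfolding measurable_cong_sets[OF stC refl] by (rule gsaw.measurable_eP)
  qed
  also have "\<dots> = (\<integral>\<^sup>+w. ennreal (pmf (gsaw_step E s n p) (p n)) * indicator {restrict p {0..<n}} w \<partial>?C)"
    by (rule nn_integral_cong) (simp add: key spC)
  also have "\<dots> = ennreal (pmf (gsaw_step E s n p) (p n)) * emeasure ?C {restrict p {0..<n}}"
    by (rule nn_integral_cmult_indicator) (simp add: stC PiM_count_space_initial)
  finally show ?case
    by (simp only: Suc.IH prod.lessThan_Suc mult.commute)
qed

lemma emeasure_gsaw_cylinder:
  fixes E :: "'v::countable \<Rightarrow> _"
  shows "emeasure (gsaw E s) {w. \<forall>i<n. w i = p i} =
    (\<Prod>i<n. ennreal (pmf (gsaw_step E s i p) (p i)))"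
proof -
  let ?S = "{restrict p {0..<n}}"
  have S: "?S \<in> sets (Pi\<^sub>M {0..<n} (\<lambda>_. count_space (UNIV::'v set)))" by (simp add: PiM_count_space_initial)
  have "{w. \<forall>i<n. w i = p i} = prod_emb UNIV (\<lambda>_. count_space (UNIV::'v set)) {0..<n} ?S"
    by (auto simp: prod_emb_def space_PiM restrict_def fun_eq_iff; metis)
  then have "emeasure (gsaw E s) {w. \<forall>i<n. w i = p i} = emeasure (gsaw.CI E s {0..<n}) ?S"
    unfolding gsaw_def using gsaw.lim[of "{0..<n}", OF _ S] by simp
  also have "\<dots> = emeasure (gsaw.C E s 0 n (\<lambda>_. undefined)) ?S"
    by (subst gsaw.emeasure_CI[OF order.refl S]) (simp add: prod_emb_id PiM_count_space_initial)
  finally show ?thesis by (simp add: emeasure_gsaw_C)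
qed

lemma prob_space_gsaw: "prob_space (gsaw E s)"
  using emeasure_gsaw_cylinder[of E s 0] by (intro prob_spaceI) (simp add: space_gsaw)

end

theory Submission
  imports Defs
begin

text \<open>
  A vertex of the ladder is determined by its first coordinate, so the ladder is the graph on the
  integers in which two numbers are adjacent iff they differ by 1 or 2 (\<open>ladder_adj_rung\<close>).

  Call the walk's position a record if it lies strictly to the right, or strictly to the left, of
  everything visited before. From a record at \<open>x\<close> (say on the right), the five steps to
  \<open>x + 1\<close>, \<open>x + 3\<close>, \<open>x + 5\<close>, \<open>x + 4\<close>, \<open>x + 2\<close> visit fresh vertices only and end at a vertex
  whose neighbours \<open>x\<close>, \<open>x + 1\<close>, \<open>x + 3\<close>, \<open>x + 4\<close> have all been used up. All degrees are at most 4,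
  so the walk is trapped in this way with conditional probability at least \<open>(1/4)\<^sup>5\<close>
  (\<open>survival_bound_record\<close>).

  With \<open>c = 1 - (1/4)\<^sup>5\<close>, it follows that after every finite history, not just at a record,
  the walk survives forever with conditional probability at most \<open>c\<close>
  (\<open>survival_bound_ladder_range\<close>): a step of an untrapped walk either sets a record or uses up one
  of the finitely many unvisited vertices in the range seen so far, and averaging over the next step
  preserves the bound.

  A conditional survival probability that is bounded away from 1 forces survival to be a null event
  (\<open>survival_null\<close>): summing the bound over the histories of length \<open>n\<close> that are not yet trapped
  gives \<open>P(survival) \<le> c * P(not trapped up to time n)\<close>, and the right-hand side tends to
  \<open>c * P(survival)\<close>.
\<close>

section \<open>Prefix events\<close>

definition prefix_event :: "(nat \<Rightarrow> 'v) \<Rightarrow> nat \<Rightarrow> (nat \<Rightarrow> 'v) set" where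
  "prefix_event p n = {w. \<forall>i\<le>n. w i = p i}"

definition survival :: "('v \<Rightarrow> 'v \<Rightarrow> bool) \<Rightarrow> (nat \<Rightarrow> 'v) set" where
  "survival E = {w. \<forall>n. \<not> trapped E w n}"

lemma measurable_coordinate_gsaw [measurable]:
  fixes E :: "'v::countable \<Rightarrow> 'v \<Rightarrow> bool"
  shows "(\<lambda>w. w i) \<in> gsaw E s \<rightarrow>\<^sub>M count_space UNIV"
  unfolding measurable_cong_sets[OF sets_gsaw refl]
  by (rule measurable_component_singleton) simp

lemma sets_prefix_event [measurable]:
  fixes E :: "'v::countable \<Rightarrow> 'v \<Rightarrow> bool"
  shows "prefix_event p n \<in> sets (gsaw E s)"
proof -
  have "prefix_event p n = {w \<in> space (gsaw E s). \<forall>i\<in>{..n}. w i = p i}"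
    by (auto simp: prefix_event_def space_gsaw)
  also have "\<dots> \<in> sets (gsaw E s)"
    by measurable
  finally show ?thesis .
qed

lemma sets_trapped:
  fixes E F :: "'v::countable \<Rightarrow> 'v \<Rightarrow> bool"
  shows "{w. trapped E w n} \<in> sets (gsaw F s)"
proof -
  have "{w. trapped E w n} =
      {w \<in> space (gsaw F s). \<forall>v. E (w n) v \<longrightarrow> (\<exists>i\<in>{..n}. w i = v)}"
    by (auto simp: trapped_def unvisited_nbrs_def space_gsaw)
  also have "\<dots> \<in> sets (gsaw F s)"
  proof -
    have [measurable]: "Measurable.pred (gsaw F s) (\<lambda>w. E (w n) v)" for v
      by (rule measurable_compose[OF measurable_coordinate_gsaw]) simp
    have [measurable]: "Measurable.pred (gsaw F s) (\<lambda>w. w i = v)" for i v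
      by (rule measurable_compose[OF measurable_coordinate_gsaw]) simp
    show ?thesis
      by measurable
  qed
  finally show ?thesis .
qed

lemma sets_survival [measurable]:
  fixes E F :: "'v::countable \<Rightarrow> 'v \<Rightarrow> bool"
  shows "survival E \<in> sets (gsaw F s)"
proof -
  have "survival E = space (gsaw F s) - (\<Union>n. {w. trapped E w n})"
    by (auto simp: survival_def space_gsaw)
  then show ?thesis
    using sets_trapped[of E _ F s] by auto
qed

lemma trapped_cong:
  assumes "\<And>i. i \<le> n \<Longrightarrow> w i = w' i"
  shows "trapped E w n = trapped E w' n"
proof -
  have "w ` {..n} = w' ` {..n}"
    by (rule image_cong) (use assms in auto)
  then show ?thesis
    using assms[of n] by (simp add: trapped_def unvisited_nbrs_def)
qed

lemma survival_disjoint_trapped_prefix: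
  assumes "trapped E p n"
  shows "prefix_event p n \<inter> survival E = {}"
proof -
  have "trapped E w n" if "w \<in> prefix_event p n" for w
    using assms trapped_cong[of n w p E] that by (auto simp: prefix_event_def)
  then show ?thesis by (auto simp: survival_def)
qed

lemma measure_prefix_event:
  fixes E :: "'v::countable \<Rightarrow> 'v \<Rightarrow> bool"
  shows "measure (gsaw E s) (prefix_event p n) = (\<Prod>i\<le>n. pmf (gsaw_step E s i p) (p i))"
proof -
  have "emeasure (gsaw E s) (prefix_event p n) = ennreal (\<Prod>i\<le>n. pmf (gsaw_step E s i p) (p i))"
    using emeasure_gsaw_cylinder[where E = E and s = s and n = "Suc n" and p = p]
    by (simp only: prefix_event_def less_Suc_eq_le lessThan_Suc_atMost) (simp add: prod_ennreal)
  then show ?thesis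
    by (simp add: measure_def prod_nonneg)
qed

lemma measure_prefix_event_Suc:
  fixes E :: "'v::countable \<Rightarrow> 'v \<Rightarrow> bool"
  shows "measure (gsaw E s) (prefix_event p (Suc n)) =
    measure (gsaw E s) (prefix_event p n) * pmf (gsaw_step E s (Suc n) p) (p (Suc n))"
  unfolding measure_prefix_event by (rule prod.atMost_Suc)

section \<open>Bounding the chance of survival\<close>

text \<open>The conditional survival bound passes from the blocks of a countable partition to their union.
  The partitions used are those by the next vertex and by the whole history up to a given time.\<close>

lemma survival_bound_UN:
  fixes E :: "'v::countable \<Rightarrow> 'v \<Rightarrow> bool"
  assumes "0 \<le> c" and "countable I" and "disjoint_family_on B I"
    and B: "\<And>i. i \<in> I \<Longrightarrow> B i \<in> sets (gsaw E s)"
    and le: "\<And>i. i \<in> I \<Longrightarrow>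
      measure (gsaw E s) (B i \<inter> survival E) \<le> c * measure (gsaw E s) (B i)"
  shows "measure (gsaw E s) ((\<Union>i\<in>I. B i) \<inter> survival E) \<le> c * measure (gsaw E s) (\<Union>i\<in>I. B i)"
proof -
  interpret prob_space "gsaw E s" by (rule prob_space_gsaw)
  let ?M = "gsaw E s"
  have "emeasure ?M (\<Union>i\<in>I. B i \<inter> survival E) =
      (\<integral>\<^sup>+i. emeasure ?M (B i \<inter> survival E) \<partial>count_space I)"
    by (rule emeasure_UN_countable)
      (use assms in \<open>auto simp: disjoint_family_on_def intro!: sets.Int sets_survival\<close>)
  also have "\<dots> \<le> (\<integral>\<^sup>+i. ennreal c * emeasure ?M (B i) \<partial>count_space I)"
    using le \<open>0 \<le> c\<close>
    by (intro nn_integral_mono)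
      (auto simp: emeasure_eq_measure ennreal_mult[symmetric] intro!: ennreal_leI)
  also have "\<dots> = ennreal c * emeasure ?M (\<Union>i\<in>I. B i)"
    using assms by (simp add: nn_integral_cmult emeasure_UN_countable)
  finally show ?thesis
    using \<open>0 \<le> c\<close> by (simp add: emeasure_eq_measure ennreal_mult[symmetric])
qed

text \<open>The survival probability after a history is the average of those after its one-step extensions.
  Extensions by anything but an unvisited neighbour of the current vertex are null, and a trapped
  history does not survive at all.\<close>

lemma survival_bound_step:
  fixes E :: "'v::countable \<Rightarrow> 'v \<Rightarrow> bool"
  assumes "0 \<le> c" and fin: "finite (unvisited_nbrs E p n)"
    and next_le: "\<And>v. v \<in> unvisited_nbrs E p n \<Longrightarrow>
      measure (gsaw E s) (prefix_event (p(Suc n := v)) (Suc n) \<inter> survival E)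
        \<le> c * measure (gsaw E s) (prefix_event (p(Suc n := v)) (Suc n))"
  shows "measure (gsaw E s) (prefix_event p n \<inter> survival E)
    \<le> c * measure (gsaw E s) (prefix_event p n)"
proof (cases "trapped E p n")
  case True
  then show ?thesis
    using \<open>0 \<le> c\<close> by (simp add: survival_disjoint_trapped_prefix)
next
  case False
  interpret prob_space "gsaw E s" by (rule prob_space_gsaw)
  let ?B = "\<lambda>v. prefix_event (p(Suc n := v)) (Suc n)"
  have split: "prefix_event p n = (\<Union>v. ?B v)"
    by (auto simp: prefix_event_def le_Suc_eq)
  have "prob (?B v \<inter> survival E) \<le> c * prob (?B v)" for v
  proof (cases "v \<in> unvisited_nbrs E p n")
    case True
    then show ?thesis by (rule next_le)
  next
    case unreachable: False
    have "gsaw_step E s (Suc n) (p(Suc n := v)) = gsaw_step E s (Suc n) p"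
      by (rule gsaw_step_cong) simp
    also have "\<dots> = pmf_of_set (unvisited_nbrs E p n)"
      using False by simp
    finally have "prob (?B v) = 0"
      using False fin unreachable
      by (simp add: measure_prefix_event_Suc trapped_def del: gsaw_step.simps)
    moreover have "prob (?B v \<inter> survival E) \<le> prob (?B v)"
      by (intro finite_measure_mono) auto
    ultimately show ?thesis by simp
  qed
  moreover have "disjoint_family ?B"
    by (auto simp: disjoint_family_on_def prefix_event_def)
  ultimately show ?thesis
    unfolding split by (intro survival_bound_UN) (use \<open>0 \<le> c\<close> in auto)
qed

text \<open>At a vertex of degree at most \<open>d\<close>, each unvisited neighbour is chosen with probability at least
  \<open>1 / d\<close>, so a prescribed self-avoiding continuation of \<open>k\<close> steps is followed with conditional
  probability at least \<open>(1 / d) ^ k\<close>.\<close>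

lemma measure_prefix_event_extend:
  fixes E :: "'v::countable \<Rightarrow> 'v \<Rightarrow> bool"
  assumes deg: "\<And>x. finite {v. E x v}" "\<And>x. card {v. E x v} \<le> d"
    and walk: "\<And>j. j < k \<Longrightarrow> p (n + Suc j) \<in> unvisited_nbrs E p (n + j)"
  shows "(1 / real d) ^ k * measure (gsaw E s) (prefix_event p n)
    \<le> measure (gsaw E s) (prefix_event p (n + k))"
  using walk
proof (induction k)
  case (Suc k)
  let ?N = "unvisited_nbrs E p (n + k)"
  have v: "p (n + Suc k) \<in> ?N"
    by (rule Suc.prems) simp
  have sub: "?N \<subseteq> {v. E (p (n + k)) v}"
    by (auto simp: unvisited_nbrs_def)
  then have fin: "finite ?N"
    using deg(1) finite_subset by blast
  have "card ?N \<le> d"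
    using card_mono[OF deg(1) sub] deg(2) order_trans by blast
  moreover have "card ?N > 0"
    using fin v card_gt_0_iff by blast
  ultimately have "1 / real d \<le> 1 / real (card ?N)"
    by (simp add: frac_le)
  also have "\<dots> = pmf (gsaw_step E s (Suc (n + k)) p) (p (Suc (n + k)))"
    using fin v by (auto simp: trapped_def)
  finally have step: "1 / real d \<le> pmf (gsaw_step E s (Suc (n + k)) p) (p (Suc (n + k)))" .
  have "(1 / real d) ^ Suc k * measure (gsaw E s) (prefix_event p n) =
      ((1 / real d) ^ k * measure (gsaw E s) (prefix_event p n)) * (1 / real d)"
    by simp
  also have "\<dots> \<le> measure (gsaw E s) (prefix_event p (n + k)) *
      pmf (gsaw_step E s (Suc (n + k)) p) (p (Suc (n + k)))"
    by (intro mult_mono step Suc.IH Suc.prems) auto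
  finally show ?case
    by (simp only: add_Suc_right measure_prefix_event_Suc)
qed simp

text \<open>A short route into a trap costs survival a fixed proportion of the mass: whoever survives does
  not follow it.\<close>

lemma survival_bound_trap_path:
  fixes E :: "'v::countable \<Rightarrow> 'v \<Rightarrow> bool"
  assumes deg: "\<And>x. finite {v. E x v}" "\<And>x. card {v. E x v} \<le> d"
    and walk: "\<And>j. j < k \<Longrightarrow> q (n + Suc j) \<in> unvisited_nbrs E q (n + j)"
    and trap: "trapped E q (n + k)"
    and agree: "\<And>i. i \<le> n \<Longrightarrow> q i = p i"
  shows "measure (gsaw E s) (prefix_event p n \<inter> survival E)
    \<le> (1 - (1 / real d) ^ k) * measure (gsaw E s) (prefix_event p n)"
proof -
  interpret prob_space "gsaw E s" by (rule prob_space_gsaw)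
  have same: "prefix_event p n = prefix_event q n"
    using agree by (auto simp: prefix_event_def)
  have "prob (prefix_event p n \<inter> survival E)
      \<le> prob (prefix_event q n - prefix_event q (n + k))"
    using survival_disjoint_trapped_prefix[OF trap]
    by (intro finite_measure_mono) (auto simp: same)
  also have "\<dots> = prob (prefix_event q n) - prob (prefix_event q (n + k))"
    by (intro finite_measure_Diff sets_prefix_event) (auto simp: prefix_event_def)
  also have "\<dots> \<le> prob (prefix_event q n) - (1 / real d) ^ k * prob (prefix_event q n)"
    using measure_prefix_event_extend[where E = E and s = s, OF deg walk, of k] by simp
  finally show ?thesis
    by (simp add: same algebra_simps)
qed

text \<open>A 0-1 law in the spirit of Levy's. Survival is the decreasing limit of the events \<open>?S n\<close> of not
  being trapped up to time \<open>n\<close>. Each of these is a countable disjoint union of prefix events, so the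
  bound on prefix events carries over to it, and in the limit to survival itself.\<close>

lemma survival_null:
  fixes E :: "'v::countable \<Rightarrow> 'v \<Rightarrow> bool"
  assumes c: "0 \<le> c" "c < 1"
    and bound: "\<And>p n. measure (gsaw E s) (prefix_event p n \<inter> survival E)
      \<le> c * measure (gsaw E s) (prefix_event p n)"
  shows "measure (gsaw E s) (survival E) = 0"
proof -
  interpret prob_space "gsaw E s" by (rule prob_space_gsaw)
  let ?S = "\<lambda>n. {w. \<forall>i\<le>n. \<not> trapped E w i}"
  have S_sets: "?S n \<in> events" for n
  proof -
    have "?S n = space (gsaw E s) - (\<Union>i\<in>{..n}. {w. trapped E w i})"
      by (auto simp: space_gsaw)
    then show ?thesis
      using sets_trapped[of E _ E s] by auto
  qed
  have bound_S: "prob (survival E) \<le> c * prob (?S n)" for n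
  proof -
    let ?I = "{p \<in> {..n} \<rightarrow>\<^sub>E UNIV. \<forall>i\<le>n. \<not> trapped E p i}"
    have "countable ({..n} \<rightarrow>\<^sub>E (UNIV :: 'v set))"
      by (intro countable_PiE) auto
    then have "countable ?I"
      by (rule countable_subset[rotated]) auto
    moreover have "disjoint_family_on (\<lambda>p. prefix_event p n) ?I"
      unfolding disjoint_family_on_def prefix_event_def
      by (auto intro!: PiE_ext)
    ultimately have "prob ((\<Union>p\<in>?I. prefix_event p n) \<inter> survival E)
        \<le> c * prob (\<Union>p\<in>?I. prefix_event p n)"
      by (intro survival_bound_UN c bound) auto
    moreover have "(\<Union>p\<in>?I. prefix_event p n) = ?S n"
    proof (intro set_eqI iffI)
      fix w assume "w \<in> (\<Union>p\<in>?I. prefix_event p n)"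
      then obtain p where p: "\<forall>i\<le>n. \<not> trapped E p i" "\<forall>i\<le>n. w i = p i"
        by (auto simp: prefix_event_def)
      then have "trapped E w i = trapped E p i" if "i \<le> n" for i
        using that by (intro trapped_cong) auto
      then show "w \<in> ?S n" using p by auto
    next
      fix w assume w: "w \<in> ?S n"
      have "trapped E (restrict w {..n}) i = trapped E w i" if "i \<le> n" for i
        using that by (intro trapped_cong) auto
      then have "restrict w {..n} \<in> ?I"
        using w by auto
      moreover have "w \<in> prefix_event (restrict w {..n}) n"
        by (auto simp: prefix_event_def)
      ultimately show "w \<in> (\<Union>p\<in>?I. prefix_event p n)"
        by blast
    qed
    moreover have "?S n \<inter> survival E = survival E"
      by (auto simp: survival_def)
    ultimately show ?thesis by simp
  qed
  have "(\<lambda>n. prob (?S n)) \<longlonglongrightarrow> prob (\<Inter>n. ?S n)"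
    by (rule finite_Lim_measure_decseq) (use S_sets in \<open>auto simp: decseq_def\<close>)
  moreover have "(\<Inter>n. ?S n) = survival E"
    by (auto simp: survival_def)
  ultimately have "(\<lambda>n. c * prob (?S n)) \<longlonglongrightarrow> c * prob (survival E)"
    by (intro tendsto_mult_left) simp
  then have "prob (survival E) \<le> c * prob (survival E)"
    using bound_S by (intro LIMSEQ_le_const) auto
  then have "(1 - c) * prob (survival E) \<le> 0"
    by (simp add: algebra_simps)
  then show ?thesis
    using c by (simp add: mult_le_0_iff measure_le_0_iff)
qed

section \<open>The triangular ladder\<close>

text \<open>The vertex with first coordinate \<open>a\<close>: the parity condition leaves one choice for the second.\<close>

definition rung :: "int \<Rightarrow> int \<times> int" where
  "rung a = (a, a mod 2)"

lemma fst_rung [simp]: "fst (rung a) = a"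
  by (simp add: rung_def)

lemma rung_eq_iff [simp]: "rung a = rung b \<longleftrightarrow> a = b"
  by (auto simp: rung_def)

lemma ladder_vertices_eq: "ladder_vertices = range rung"
proof (intro set_eqI iffI)
  fix x assume "x \<in> ladder_vertices"
  then have "x = rung (fst x)"
    by (cases x) (auto simp: ladder_vertices_def rung_def; presburger)
  then show "x \<in> range rung" by auto
qed (auto simp: ladder_vertices_def rung_def; presburger)

lemma ladder_adj_rung: "ladder_adj (rung a) (rung b) \<longleftrightarrow> \<bar>a - b\<bar> = 1 \<or> \<bar>a - b\<bar> = 2"
  unfolding ladder_adj_def rung_def ladder_vertices_def by auto presburger+

lemma ladder_adj_vertices: "ladder_adj x y \<Longrightarrow> x \<in> ladder_vertices \<and> y \<in> ladder_vertices"
  by (auto simp: ladder_adj_def)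

lemma ladder_nbrs_subset:
  "{v. ladder_adj x v} \<subseteq> rung ` {fst x - 2, fst x - 1, fst x + 1, fst x + 2}"
proof
  fix v assume "v \<in> {v. ladder_adj x v}"
  then have adj: "ladder_adj x v" by simp
  then obtain a b where ab: "x = rung a" "v = rung b"
    using ladder_adj_vertices[OF adj] by (auto simp: ladder_vertices_eq)
  with adj have "\<bar>a - b\<bar> = 1 \<or> \<bar>a - b\<bar> = 2"
    by (simp add: ladder_adj_rung)
  then have "b \<in> {a - 2, a - 1, a + 1, a + 2}" by auto
  then show "v \<in> rung ` {fst x - 2, fst x - 1, fst x + 1, fst x + 2}"
    unfolding ab fst_rung by (rule imageI)
qed

lemma ladder_degree:
  shows "finite {v. ladder_adj x v}" and "card {v. ladder_adj x v} \<le> 4"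
proof -
  let ?N = "rung ` {fst x - 2, fst x - 1, fst x + 1, fst x + 2}"
  show "finite {v. ladder_adj x v}"
    using ladder_nbrs_subset by (rule finite_subset) simp
  have "card {v. ladder_adj x v} \<le> card ?N"
    using ladder_nbrs_subset by (intro card_mono) auto
  also have "\<dots> \<le> 4"
    by (rule order_trans[OF card_image_le]) (auto simp: card_insert_if)
  finally show "card {v. ladder_adj x v} \<le> 4" .
qed

text \<open>At a record everything ahead is unvisited, so the walk can run ahead along odd offsets and come
  back along even ones until it is enclosed: offset 2 has the neighbours 0, 1, 3, 4. The sign
  \<open>\<sigma>\<close> is the direction of the record.\<close>

lemma survival_bound_record:
  assumes sgn: "\<sigma> = 1 \<or> \<sigma> = -1" and cur: "p n = rung a"
    and rec: "\<And>i. i < n \<Longrightarrow> \<sigma> * fst (p i) < \<sigma> * a"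
  shows "measure (gsaw ladder_adj s) (prefix_event p n \<inter> survival ladder_adj)
    \<le> (1 - (1 / 4) ^ 5) * measure (gsaw ladder_adj s) (prefix_event p n)"
proof -
  \<comment> \<open>The trap path as offsets from the record vertex, preceded by the record vertex itself.\<close>
  define off :: "nat \<Rightarrow> int" where "off j = [0, 1, 3, 5, 4, 2] ! j" for j
  define q where "q i = (if i \<le> n then p i else rung (a + \<sigma> * off (i - n)))" for i
  have off: "off 0 = 0" "off 1 = 1" "off 2 = 3" "off 3 = 5" "off 4 = 4" "off 5 = 2"
    by (simp_all add: off_def numeral_eq_Suc)
  have q: "q (n + j) = rung (a + \<sigma> * off j)" for j
    using cur by (cases j) (simp_all add: q_def off)
  have behind: "\<sigma> * fst (q i) \<le> \<sigma> * a" if "i \<le> n" for i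
    using that rec[of i] cur by (cases "i = n") (auto simp: q_def)
  have fresh: "q (n + Suc j) \<notin> q ` {..n + j}" if "j < 5" for j
  proof
    assume "q (n + Suc j) \<in> q ` {..n + j}"
    then obtain i where i: "i \<le> n + j" "q i = rung (a + \<sigma> * off (Suc j))"
      using q[of "Suc j"] by auto
    have pos: "off (Suc j) > 0"
      using that by (auto simp: off_def less_Suc_eq numeral_eq_Suc)
    show False
    proof (cases "i \<le> n")
      case True
      then show False
        using behind[OF True] i(2) pos sgn by (auto simp: algebra_simps)
    next
      case False
      then obtain k where k: "i = n + k" "k \<le> j"
        using i(1) by (metis add_le_cancel_left le_Suc_ex nat_le_linear)
      then have "off k = off (Suc j)"
        using i(2) q[of k] sgn by auto
      moreover have "distinct [0, 1, 3, 5, 4, 2 :: int]" by simp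
      ultimately show False
        using k that unfolding off_def by (subst (asm) nth_eq_iff_index_eq) auto
    qed
  qed
  have adj: "ladder_adj (q (n + j)) (q (n + Suc j))" if "j < 5" for j
  proof -
    have "j \<in> {0, 1, 2, 3, 4}" using that by auto
    then show ?thesis
      unfolding q ladder_adj_rung using sgn by (auto simp: off_def numeral_eq_Suc)
  qed
  have walk: "q (n + Suc j) \<in> unvisited_nbrs ladder_adj q (n + j)" if "j < 5" for j
    using adj[OF that] fresh[OF that] by (simp add: unvisited_nbrs_def)
  have trap: "trapped ladder_adj q (n + 5)"
  proof -
    have "v \<in> q ` {..n + 5}" if adj: "ladder_adj (q (n + 5)) v" for v
    proof -
      obtain b where b: "v = rung b"
        using ladder_adj_vertices[OF adj] by (auto simp: ladder_vertices_eq)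
      have "\<bar>(a + \<sigma> * 2) - b\<bar> = 1 \<or> \<bar>(a + \<sigma> * 2) - b\<bar> = 2"
        using adj unfolding q b ladder_adj_rung off .
      then have "b = a + \<sigma> * off 0 \<or> b = a + \<sigma> * off 1 \<or> b = a + \<sigma> * off 2 \<or> b = a + \<sigma> * off 4"
        unfolding off using sgn by auto
      then have "v = q (n + 0) \<or> v = q (n + 1) \<or> v = q (n + 2) \<or> v = q (n + 4)"
        unfolding q b by auto
      then show ?thesis by auto
    qed
    then show ?thesis by (auto simp: trapped_def unvisited_nbrs_def)
  qed
  have "measure (gsaw ladder_adj s) (prefix_event p n \<inter> survival ladder_adj)
    \<le> (1 - (1 / real 4) ^ 5) * measure (gsaw ladder_adj s) (prefix_event p n)"
    by (rule survival_bound_trap_path[OF ladder_degree walk trap]) (auto simp: q_def)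
  then show ?thesis by simp
qed

text \<open>Induction on the number of unvisited vertices in a range \<open>{lo..hi}\<close> that contains the history.
  A step to a fresh vertex inside the range decreases this number; a step outside it is a record.\<close>

lemma survival_bound_ladder_range:
  assumes "\<And>i. i \<le> n \<Longrightarrow> fst (p i) \<in> {lo..hi}"
  shows "measure (gsaw ladder_adj s) (prefix_event p n \<inter> survival ladder_adj)
    \<le> (1 - (1 / 4) ^ 5) * measure (gsaw ladder_adj s) (prefix_event p n)"
  using assms
proof (induction "card (rung ` {lo..hi} - p ` {..n})" arbitrary: p n rule: less_induct)
  case less
  show ?case
  proof (rule survival_bound_step)
    have "unvisited_nbrs ladder_adj p n \<subseteq> {v. ladder_adj (p n) v}"
      by (auto simp: unvisited_nbrs_def)
    then show "finite (unvisited_nbrs ladder_adj p n)"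
      by (rule finite_subset) (rule ladder_degree)
  next
    fix v assume "v \<in> unvisited_nbrs ladder_adj p n"
    then have new: "v \<notin> p ` {..n}" and adj: "ladder_adj (p n) v"
      by (auto simp: unvisited_nbrs_def)
    obtain b where b: "v = rung b"
      using ladder_adj_vertices[OF adj] by (auto simp: ladder_vertices_eq)
    let ?p = "p(Suc n := v)"
    consider "b \<in> {lo..hi}" | "b > hi" | "b < lo" by fastforce
    then show "measure (gsaw ladder_adj s) (prefix_event ?p (Suc n) \<inter> survival ladder_adj)
        \<le> (1 - (1 / 4) ^ 5) * measure (gsaw ladder_adj s) (prefix_event ?p (Suc n))"
    proof cases
      case 1
      have "?p ` {..Suc n} = insert v (p ` {..n})"
        by (auto simp: atMost_Suc)
      then have "rung ` {lo..hi} - ?p ` {..Suc n} \<subset> rung ` {lo..hi} - p ` {..n}"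
        using 1 new b by auto
      then have "card (rung ` {lo..hi} - ?p ` {..Suc n}) < card (rung ` {lo..hi} - p ` {..n})"
        by (intro psubset_card_mono) auto
      then show ?thesis
        by (rule less.hyps) (use less.prems 1 b in \<open>auto simp: le_Suc_eq\<close>)
    next
      case 2
      show ?thesis
      proof (rule survival_bound_record[where \<sigma> = 1 and a = b])
        fix i assume "i < Suc n"
        then show "1 * fst (?p i) < 1 * b"
          using less.prems[of i] 2 by auto
      qed (use b in auto)
    next
      case 3
      show ?thesis
      proof (rule survival_bound_record[where \<sigma> = "-1" and a = b])
        fix i assume "i < Suc n"
        then show "-1 * fst (?p i) < -1 * b"
          using less.prems[of i] 3 by auto
      qed (use b in auto)
    qed
  qed (simp add: power_le_one)
qed

lemma survival_bound_ladder:
  "measure (gsaw ladder_adj s) (prefix_event p n \<inter> survival ladder_adj)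
    \<le> (1 - (1 / 4) ^ 5) * measure (gsaw ladder_adj s) (prefix_event p n)"
proof (rule survival_bound_ladder_range)
  fix i assume "i \<le> n"
  then show "fst (p i) \<in> {Min ((fst \<circ> p) ` {..n})..Max ((fst \<circ> p) ` {..n})}"
    by (auto intro!: Min_le Max_ge)
qed

theorem corollary2p45:
  fixes s :: "int \<times> int"
  assumes "s \<in> ladder_vertices"
  shows "\<P>(w in gsaw ladder_adj s. \<exists>n. trapped ladder_adj w n) = 1"
proof -
  interpret prob_space "gsaw ladder_adj s" by (rule prob_space_gsaw)
  have "prob (survival ladder_adj) = 0"
    by (rule survival_null[OF _ _ survival_bound_ladder]) (auto simp: power_le_one)
  then have "prob (space (gsaw ladder_adj s) - survival ladder_adj) = 1"
    by (subst prob_compl) auto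
  moreover have "{w \<in> space (gsaw ladder_adj s). \<exists>n. trapped ladder_adj w n} =
      space (gsaw ladder_adj s) - survival ladder_adj"
    by (auto simp: survival_def)
  ultimately show ?thesis by simp
qed

end
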